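(* Let $(\mathbb{X},\perp)$ be a disjoint $\perp$-restriction category. Then for all $\perp$-disjoint maps $f: X \to X$ and $g: X \to A$ the formula $$ f \circledast g := \bigsqcup_{n \in \mathbb{N}} f^n g \qquad (f^0 = 1_X) $$ defines a strongly inductive Kleene wand $\circledast$ on $(\mathbb{X},\perp)$. Thus $(\mathbb{X},\circledast)$ is a strongly inductive $\perp$-itegory.
   Context: Composition is diagrammatic: $fg$ means first $f$, then $g$. A restriction category is a category with an operator sending each $f:A\to B$ to $\overline{f}:A\to A$ such that $\overline{f}f=f$; $\overline{f}\,\overline{g}=\overline{g}\,\overline{f}$ and $\overline{\overline{g}f}=\overline{g}\,\overline{f}$ for $f:A\to B$, $g:A\to C$; and $f\overline{g}=\overline{fg}f$ for $f:A\to B$, $g:B\to C$. For parallel $f,g$: $f\le g$ iff $\overline{f}g=f$ (a partial order). It has restriction zeroes if there are maps $0:A\to B$ with $f0=0=0f$ and $\overline{0}=0$. An interference relation $\perp$ on a restriction category with restriction zeroes is a family of relations between maps with the same domain ($f:A\to B$, $g:A\to C$) such that: $1_A\perp 0$; $f\perp g\Rightarrow g\perp f$; $f\perp f\Rightarrow f=0$; $f'\perp g'$, $f\le f'$, $g\le g'$ imply $f\perp g$; $f\perp g\Rightarrow hfk\perp hgk'$ for all composable $h,k,k'$; $f\perp g\Rightarrow\overline{f}\perp\overline{g}$. A $\perp$-restriction category is a restriction category with restriction zeroes and a chosen interference relation $\perp$. The $\perp$-join $\bigsqcup_{i\in I}f_i$ of a family of parallel maps $f_i:A\to B$ with $f_i\perp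 f_j$ for $i\ne j$ is their least upper bound with respect to $\le$, if it exists. $\mathbb{X}$ has all (binary, finite) $\perp$-joins if these exist for all (two-element, finite) pairwise $\perp$-disjoint families and $h\bigsqcup_i f_i=\bigsqcup_i hf_i$ for all $h:A'\to A$. A $\perp$-join is strong if whenever $f_i\perp h$ for all $i$, then $\bigsqcup_i f_i\perp h$. A disjoint $\perp$-restriction category is a $\perp$-restriction category having all $\perp$-joins (arbitrary index sets), every one of which is strong. A Kleene wand $\circledast$ on a $\perp$-restriction category with all binary $\perp$-joins assigns to each $f:X\to X$, $g:X\to A$ with $f\perp g$ a map $f\circledast g:X\to A$ such that: (1) if $f \perp g$, then $g\sqcup f(f\circledast g)=f\circledast g$; (2) $(f\circledast g)h=f\circledast gh$ for $f\perp g$, $h:A\to B$; (3) for $f:X\to Y$, $g:X\to A$, $k:Y\to X$ with $f\perp g$: $kf\circledast kg=k(fk\circledast g)$; (4) for $f,f':X\to X$, $g:X\to A$ with $f\perp f'$ and $f\sqcup f'\perp g$: $(f\circledast f')\perp(f\circledast g)$ and $(f\sqcup f')\circledast g=(f\circledast f')\circledast(f\circledast g)$. A $\perp$-itegory is a $\perp$-restriction category with all binary $\perp$-joins and a Kleene wand. Below $f:X\to X$, $g:X\to A$, $f':Y\to Y$, $g':Y\to A$, $h:X\to Y$, $f\perp g$, $f'\perp g'$. The wand is: uniform if $hg'=g$ and $hf'=fh$ imply $h(f'\circledast g')=f\circledast g$; lax uniform if $g\le hg'$ and $fh\le hf'$ imply $f\circledast g\le h(f'\circledast g')$; colax uniform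 if $g\ge hg'$ and $fh\ge hf'$ imply $f\circledast g\ge h(f'\circledast g')$; strongly uniform if it satisfies any two (equivalently all three) of these; inductive if $f\perp g$, $fh\le h$, $g\le h$ (with $h:X\to A$) imply $f\circledast g\le h$; strongly inductive if both strongly uniform and inductive. A $\perp$-itegory is strongly inductive if its Kleene wand is. *)

theory Defs
  imports Main
begin

text \<open>
  Composition is written in diagrammatic order: \<open>f \<Zsemi> g\<close> is first \<open>f\<close>, then \<open>g\<close>.
\<close>

record ('o, 'a) cat_struct =
  Obj :: "'o set"
  Arr :: "'a set"
  Dom :: "'a \<Rightarrow> 'o"
  Cod :: "'a \<Rightarrow> 'o"
  Id :: "'o \<Rightarrow> 'a"
  Comp :: "'a \<Rightarrow> 'a \<Rightarrow> 'a" (infixl \<open>\<Zsemi>\<index>\<close> 70)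

definition hom :: "('o, 'a, 'm) cat_struct_scheme \<Rightarrow> 'o \<Rightarrow> 'o \<Rightarrow> 'a set" where
  "hom C A B = {f \<in> Arr C. Dom C f = A \<and> Cod C f = B}"

locale category =
  fixes C :: "('o, 'a, 'm) cat_struct_scheme" (structure)
  assumes Dom_in_Obj: "f \<in> Arr C \<Longrightarrow> Dom C f \<in> Obj C"
    and Cod_in_Obj: "f \<in> Arr C \<Longrightarrow> Cod C f \<in> Obj C"
    and Id_in_hom: "A \<in> Obj C \<Longrightarrow> Id C A \<in> hom C A A"
    and Comp_in_hom: "f \<in> hom C A B \<Longrightarrow> g \<in> hom C B D \<Longrightarrow> f \<Zsemi> g \<in> hom C A D"
    and Id_left: "f \<in> hom C A B \<Longrightarrow> Id C A \<Zsemi> f = f"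
    and Id_right: "f \<in> hom C A B \<Longrightarrow> f \<Zsemi> Id C B = f"
    and Comp_assoc: "f \<in> hom C A B \<Longrightarrow> g \<in> hom C B D \<Longrightarrow> h \<in> hom C D E \<Longrightarrow>
      (f \<Zsemi> g) \<Zsemi> h = f \<Zsemi> (g \<Zsemi> h)"

primrec iter :: "('o, 'a, 'm) cat_struct_scheme \<Rightarrow> 'a \<Rightarrow> nat \<Rightarrow> 'a" where
  "iter C f 0 = Id C (Dom C f)"
| "iter C f (Suc n) = f \<Zsemi>\<^bsub>C\<^esub> iter C f n"

record ('o, 'a) restr_struct = "('o, 'a) cat_struct" +
  restr :: "'a \<Rightarrow> 'a" (\<open>\<rho>\<index>\<close>)

locale restriction_category = category C
  for C :: "('o, 'a, 'm) restr_struct_scheme" (structure) +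
  assumes restr_in_hom: "f \<in> hom C A B \<Longrightarrow> \<rho> f \<in> hom C A A"
    and restr_comp: "f \<in> hom C A B \<Longrightarrow> \<rho> f \<Zsemi> f = f"
    and restr_commute: "f \<in> hom C A B \<Longrightarrow> g \<in> hom C A D \<Longrightarrow> \<rho> f \<Zsemi> \<rho> g = \<rho> g \<Zsemi> \<rho> f"
    and restr_restr_comp: "f \<in> hom C A B \<Longrightarrow> g \<in> hom C A D \<Longrightarrow> \<rho> (\<rho> g \<Zsemi> f) = \<rho> g \<Zsemi> \<rho> f"
    and comp_restr: "f \<in> hom C A B \<Longrightarrow> g \<in> hom C B D \<Longrightarrow> f \<Zsemi> \<rho> g = \<rho> (f \<Zsemi> g) \<Zsemi> f"

definition le :: "('o, 'a, 'm) restr_struct_scheme \<Rightarrow> 'a \<Rightarrow> 'a \<Rightarrow> bool" (infix \<open>\<sqsubseteq>\<index>\<close> 50) where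
  "f \<sqsubseteq>\<^bsub>C\<^esub> g \<longleftrightarrow> f \<in> Arr C \<and> g \<in> Arr C \<and> Dom C f = Dom C g \<and> Cod C f = Cod C g \<and>
     \<rho>\<^bsub>C\<^esub> f \<Zsemi>\<^bsub>C\<^esub> g = f"

text \<open>
  Restriction zeroes are unique when they exist, so carrying them as data is harmless.
\<close>

record ('o, 'a) restr_zero_struct = "('o, 'a) restr_struct" +
  Zero :: "'o \<Rightarrow> 'o \<Rightarrow> 'a"

locale restriction_category_with_zeroes = restriction_category C
  for C :: "('o, 'a, 'm) restr_zero_struct_scheme" (structure) +
  assumes Zero_in_hom: "A \<in> Obj C \<Longrightarrow> B \<in> Obj C \<Longrightarrow> Zero C A B \<in> hom C A B"
    and comp_Zero: "f \<in> hom C A B \<Longrightarrow> D \<in> Obj C \<Longrightarrow> f \<Zsemi> Zero C B D = Zero C A D"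
    and Zero_comp: "A \<in> Obj C \<Longrightarrow> f \<in> hom C B D \<Longrightarrow> Zero C A B \<Zsemi> f = Zero C A D"
    and restr_Zero: "A \<in> Obj C \<Longrightarrow> B \<in> Obj C \<Longrightarrow> \<rho> (Zero C A B) = Zero C A A"

record ('o, 'a) perp_struct = "('o, 'a) restr_zero_struct" +
  perp :: "'a \<Rightarrow> 'a \<Rightarrow> bool" (infix \<open>\<bottom>\<index>\<close> 50)

locale perp_restriction_category = restriction_category_with_zeroes C
  for C :: "('o, 'a, 'm) perp_struct_scheme" (structure) +
  assumes perp_maps: "f \<bottom> g \<Longrightarrow> f \<in> Arr C \<and> g \<in> Arr C \<and> Dom C f = Dom C g"
    and Id_perp_Zero: "A \<in> Obj C \<Longrightarrow> B \<in> Obj C \<Longrightarrow> Id C A \<bottom> Zero C A B"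
    and perp_sym: "f \<bottom> g \<Longrightarrow> g \<bottom> f"
    and perp_self: "f \<in> hom C A B \<Longrightarrow> f \<bottom> f \<Longrightarrow> f = Zero C A B"
    and perp_down: "f' \<bottom> g' \<Longrightarrow> f \<sqsubseteq> f' \<Longrightarrow> g \<sqsubseteq> g' \<Longrightarrow> f \<bottom> g"
    and perp_comp: "f \<in> hom C A B \<Longrightarrow> g \<in> hom C A D \<Longrightarrow> f \<bottom> g \<Longrightarrow>
      h \<in> hom C A' A \<Longrightarrow> k \<in> hom C B B' \<Longrightarrow> k' \<in> hom C D D' \<Longrightarrow> h \<Zsemi> f \<Zsemi> k \<bottom> h \<Zsemi> g \<Zsemi> k'"
    and perp_restr: "f \<bottom> g \<Longrightarrow> \<rho> f \<bottom> \<rho> g"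

definition disj_family ::
  "('o, 'a, 'm) perp_struct_scheme \<Rightarrow> 'o \<Rightarrow> 'o \<Rightarrow> 'i set \<Rightarrow> ('i \<Rightarrow> 'a) \<Rightarrow> bool" where
  "disj_family C A B I f \<longleftrightarrow> A \<in> Obj C \<and> B \<in> Obj C \<and> (\<forall>i\<in>I. f i \<in> hom C A B) \<and>
     (\<forall>i\<in>I. \<forall>j\<in>I. i \<noteq> j \<longrightarrow> f i \<bottom>\<^bsub>C\<^esub> f j)"

definition is_join ::
  "('o, 'a, 'm) restr_struct_scheme \<Rightarrow> 'o \<Rightarrow> 'o \<Rightarrow> 'i set \<Rightarrow> ('i \<Rightarrow> 'a) \<Rightarrow> 'a \<Rightarrow> bool" where
  "is_join C A B I f u \<longleftrightarrow> u \<in> hom C A B \<and> (\<forall>i\<in>I. f i \<sqsubseteq>\<^bsub>C\<^esub> u) \<and>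
     (\<forall>v\<in>hom C A B. (\<forall>i\<in>I. f i \<sqsubseteq>\<^bsub>C\<^esub> v) \<longrightarrow> u \<sqsubseteq>\<^bsub>C\<^esub> v)"

definition Join ::
  "('o, 'a, 'm) restr_struct_scheme \<Rightarrow> 'o \<Rightarrow> 'o \<Rightarrow> 'i set \<Rightarrow> ('i \<Rightarrow> 'a) \<Rightarrow> 'a" where
  "Join C A B I f = (THE u. is_join C A B I f u)"

definition join2 :: "('o, 'a, 'm) restr_struct_scheme \<Rightarrow> 'a \<Rightarrow> 'a \<Rightarrow> 'a" (infixl \<open>\<squnion>\<index>\<close> 65) where
  "f \<squnion>\<^bsub>C\<^esub> g = Join C (Dom C f) (Cod C f) (UNIV :: bool set) (\<lambda>b. if b then f else g)"

definition has_joins_over :: "('o, 'a, 'm) perp_struct_scheme \<Rightarrow> 'i set \<Rightarrow> bool" where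
  "has_joins_over C I \<longleftrightarrow> (\<forall>A B f. disj_family C A B I f \<longrightarrow>
     (\<exists>u. is_join C A B I f u) \<and>
     (\<forall>A' h. h \<in> hom C A' A \<longrightarrow>
        h \<Zsemi>\<^bsub>C\<^esub> Join C A B I f = Join C A' B I (\<lambda>i. h \<Zsemi>\<^bsub>C\<^esub> f i)))"

definition strong_joins_over :: "('o, 'a, 'm) perp_struct_scheme \<Rightarrow> 'i set \<Rightarrow> bool" where
  "strong_joins_over C I \<longleftrightarrow> (\<forall>A B f D h. disj_family C A B I f \<longrightarrow> h \<in> hom C A D \<longrightarrow>
     (\<forall>i\<in>I. f i \<bottom>\<^bsub>C\<^esub> h) \<longrightarrow> Join C A B I f \<bottom>\<^bsub>C\<^esub> h)"

definition has_binary_joins :: "('o, 'a, 'm) perp_struct_scheme \<Rightarrow> bool" where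
  "has_binary_joins C \<longleftrightarrow> has_joins_over C (UNIV :: bool set)"

text \<open>
  Families over arbitrary index sets: a definition cannot quantify over index types, so the index
  sets below are the sets of elements of the type of maps. This loses nothing, because a pairwise
  disjoint family has the same upper bounds as its image, which is a pairwise disjoint family
  indexed by itself; see lemmas \<open>joins_over_any\<close> and \<open>strong_joins_over_any\<close>, where the index
  type is arbitrary.
\<close>

locale disjoint_perp_restriction_category = perp_restriction_category C
  for C :: "('o, 'a, 'm) perp_struct_scheme" (structure) +
  assumes all_joins: "\<forall>I :: 'a set. has_joins_over C I"
    and all_joins_strong: "\<forall>I :: 'a set. strong_joins_over C I"

lemma disj_family_image:
  assumes "disj_family C A B I f"
  shows "disj_family C A B (f ` I) (\<lambda>x. x)"
  using assms unfolding disj_family_def by (metis imageE)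

lemma is_join_image: "is_join C A B (f ` I) (\<lambda>x. k x) = is_join C A B I (\<lambda>i. k (f i))"
  by (rule ext) (auto simp: is_join_def)

lemma Join_image: "Join C A B (f ` I) (\<lambda>x. k x) = Join C A B I (\<lambda>i. k (f i))"
  unfolding Join_def is_join_image ..

lemma (in disjoint_perp_restriction_category) joins_over_any: "has_joins_over C (I :: 'i set)"
  unfolding has_joins_over_def
proof (intro allI impI conjI)
  fix A B and f :: "'i \<Rightarrow> 'a" assume d: "disj_family C A B I f"
  note J = all_joins[rule_format, of "f ` I", unfolded has_joins_over_def, rule_format,
      OF disj_family_image[OF d]]
  show "\<exists>u. is_join C A B I f u"
    using J by (simp add: is_join_image)
  fix A' h assume "h \<in> hom C A' A"
  then show "h \<Zsemi> Join C A B I f = Join C A' B I (\<lambda>i. h \<Zsemi> f i)"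
    using J by (simp add: Join_image)
qed

lemma (in disjoint_perp_restriction_category) strong_joins_over_any:
  "strong_joins_over C (I :: 'i set)"
  unfolding strong_joins_over_def
proof (intro allI impI)
  fix A B D h and f :: "'i \<Rightarrow> 'a"
  assume d: "disj_family C A B I f" and h: "h \<in> hom C A D" "\<forall>i\<in>I. f i \<bottom> h"
  have "Join C A B (f ` I) (\<lambda>x. x) \<bottom> h"
    using all_joins_strong[rule_format, of "f ` I", unfolded strong_joins_over_def, rule_format,
      OF disj_family_image[OF d] h(1)] h(2) by blast
  then show "Join C A B I f \<bottom> h"
    by (simp add: Join_image)
qed

text \<open>
  A wand is a binary function on maps of which only the values at pairs
  \<open>f : P \<rightarrow> P\<close>, \<open>g : P \<rightarrow> A\<close> with \<open>f \<bottom> g\<close> matter.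
\<close>

locale kleene_wand = perp_restriction_category C
  for C :: "('o, 'a, 'm) perp_struct_scheme" (structure)
    and wand :: "'a \<Rightarrow> 'a \<Rightarrow> 'a" (infixl \<open>\<circledast>\<close> 68) +
  assumes binary_joins: "has_binary_joins C"
    and wand_in_hom: "f \<in> hom C P P \<Longrightarrow> g \<in> hom C P A \<Longrightarrow> f \<bottom> g \<Longrightarrow> f \<circledast> g \<in> hom C P A"
    and wand_unfold: "f \<in> hom C P P \<Longrightarrow> g \<in> hom C P A \<Longrightarrow> f \<bottom> g \<Longrightarrow>
      g \<squnion> (f \<Zsemi> (f \<circledast> g)) = f \<circledast> g"
    and wand_comp: "f \<in> hom C P P \<Longrightarrow> g \<in> hom C P A \<Longrightarrow> f \<bottom> g \<Longrightarrow> h \<in> hom C A B \<Longrightarrow>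
      (f \<circledast> g) \<Zsemi> h = f \<circledast> (g \<Zsemi> h)"
    and wand_dinatural: "f \<in> hom C P Q \<Longrightarrow> g \<in> hom C P A \<Longrightarrow> k \<in> hom C Q P \<Longrightarrow> f \<bottom> g \<Longrightarrow>
      (k \<Zsemi> f) \<circledast> (k \<Zsemi> g) = k \<Zsemi> ((f \<Zsemi> k) \<circledast> g)"
    and wand_diag_perp: "f \<in> hom C P P \<Longrightarrow> f' \<in> hom C P P \<Longrightarrow> g \<in> hom C P A \<Longrightarrow>
      f \<bottom> f' \<Longrightarrow> (f \<squnion> f') \<bottom> g \<Longrightarrow> (f \<circledast> f') \<bottom> (f \<circledast> g)"
    and wand_diag: "f \<in> hom C P P \<Longrightarrow> f' \<in> hom C P P \<Longrightarrow> g \<in> hom C P A \<Longrightarrow>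
      f \<bottom> f' \<Longrightarrow> (f \<squnion> f') \<bottom> g \<Longrightarrow> (f \<squnion> f') \<circledast> g = (f \<circledast> f') \<circledast> (f \<circledast> g)"

definition uniform :: "('o, 'a, 'm) perp_struct_scheme \<Rightarrow> ('a \<Rightarrow> 'a \<Rightarrow> 'a) \<Rightarrow> bool" where
  "uniform C w \<longleftrightarrow> (\<forall>P Q A. \<forall>f \<in> hom C P P. \<forall>g \<in> hom C P A. \<forall>f' \<in> hom C Q Q. \<forall>g' \<in> hom C Q A.
     \<forall>h \<in> hom C P Q. f \<bottom>\<^bsub>C\<^esub> g \<longrightarrow> f' \<bottom>\<^bsub>C\<^esub> g' \<longrightarrow>
     h \<Zsemi>\<^bsub>C\<^esub> g' = g \<longrightarrow> h \<Zsemi>\<^bsub>C\<^esub> f' = f \<Zsemi>\<^bsub>C\<^esub> h \<longrightarrow> h \<Zsemi>\<^bsub>C\<^esub> w f' g' = w f g)"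

definition lax_uniform :: "('o, 'a, 'm) perp_struct_scheme \<Rightarrow> ('a \<Rightarrow> 'a \<Rightarrow> 'a) \<Rightarrow> bool" where
  "lax_uniform C w \<longleftrightarrow> (\<forall>P Q A. \<forall>f \<in> hom C P P. \<forall>g \<in> hom C P A. \<forall>f' \<in> hom C Q Q. \<forall>g' \<in> hom C Q A.
     \<forall>h \<in> hom C P Q. f \<bottom>\<^bsub>C\<^esub> g \<longrightarrow> f' \<bottom>\<^bsub>C\<^esub> g' \<longrightarrow>
     g \<sqsubseteq>\<^bsub>C\<^esub> h \<Zsemi>\<^bsub>C\<^esub> g' \<longrightarrow> f \<Zsemi>\<^bsub>C\<^esub> h \<sqsubseteq>\<^bsub>C\<^esub> h \<Zsemi>\<^bsub>C\<^esub> f' \<longrightarrow> w f g \<sqsubseteq>\<^bsub>C\<^esub> h \<Zsemi>\<^bsub>C\<^esub> w f' g')"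

definition colax_uniform :: "('o, 'a, 'm) perp_struct_scheme \<Rightarrow> ('a \<Rightarrow> 'a \<Rightarrow> 'a) \<Rightarrow> bool" where
  "colax_uniform C w \<longleftrightarrow> (\<forall>P Q A. \<forall>f \<in> hom C P P. \<forall>g \<in> hom C P A. \<forall>f' \<in> hom C Q Q. \<forall>g' \<in> hom C Q A.
     \<forall>h \<in> hom C P Q. f \<bottom>\<^bsub>C\<^esub> g \<longrightarrow> f' \<bottom>\<^bsub>C\<^esub> g' \<longrightarrow>
     h \<Zsemi>\<^bsub>C\<^esub> g' \<sqsubseteq>\<^bsub>C\<^esub> g \<longrightarrow> h \<Zsemi>\<^bsub>C\<^esub> f' \<sqsubseteq>\<^bsub>C\<^esub> f \<Zsemi>\<^bsub>C\<^esub> h \<longrightarrow> h \<Zsemi>\<^bsub>C\<^esub> w f' g' \<sqsubseteq>\<^bsub>C\<^esub> w f g)"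

definition strongly_uniform :: "('o, 'a, 'm) perp_struct_scheme \<Rightarrow> ('a \<Rightarrow> 'a \<Rightarrow> 'a) \<Rightarrow> bool" where
  "strongly_uniform C w \<longleftrightarrow> uniform C w \<and> lax_uniform C w \<and> colax_uniform C w"

definition inductive_wand :: "('o, 'a, 'm) perp_struct_scheme \<Rightarrow> ('a \<Rightarrow> 'a \<Rightarrow> 'a) \<Rightarrow> bool" where
  "inductive_wand C w \<longleftrightarrow> (\<forall>P A. \<forall>f \<in> hom C P P. \<forall>g \<in> hom C P A. \<forall>h \<in> hom C P A.
     f \<bottom>\<^bsub>C\<^esub> g \<longrightarrow> f \<Zsemi>\<^bsub>C\<^esub> h \<sqsubseteq>\<^bsub>C\<^esub> h \<longrightarrow> g \<sqsubseteq>\<^bsub>C\<^esub> h \<longrightarrow> w f g \<sqsubseteq>\<^bsub>C\<^esub> h)"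

definition strongly_inductive :: "('o, 'a, 'm) perp_struct_scheme \<Rightarrow> ('a \<Rightarrow> 'a \<Rightarrow> 'a) \<Rightarrow> bool" where
  "strongly_inductive C w \<longleftrightarrow> strongly_uniform C w \<and> inductive_wand C w"

definition perp_itegory :: "('o, 'a, 'm) perp_struct_scheme \<Rightarrow> ('a \<Rightarrow> 'a \<Rightarrow> 'a) \<Rightarrow> bool" where
  "perp_itegory C w \<longleftrightarrow> perp_restriction_category C \<and> has_binary_joins C \<and> kleene_wand C w"

definition strongly_inductive_perp_itegory ::
  "('o, 'a, 'm) perp_struct_scheme \<Rightarrow> ('a \<Rightarrow> 'a \<Rightarrow> 'a) \<Rightarrow> bool" where
  "strongly_inductive_perp_itegory C w \<longleftrightarrow> perp_itegory C w \<and> strongly_inductive C w"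

definition iter_wand :: "('o, 'a, 'm) restr_struct_scheme \<Rightarrow> 'a \<Rightarrow> 'a \<Rightarrow> 'a" where
  "iter_wand C f g = Join C (Dom C g) (Cod C g) (UNIV :: nat set) (\<lambda>n. iter C f n \<Zsemi>\<^bsub>C\<^esub> g)"

end

theory Submission
  imports Defs
begin

text \<open>
  Joins distribute over composition on the left by hypothesis. They also distribute on the right:
  \<open>\<rho> (\<Squnion>f\<^sub>i) = \<Squnion>\<rho> f\<^sub>i\<close>, and since restriction idempotents commute, left distributivity gives
  \<open>(\<Squnion>e\<^sub>i) x = \<Squnion>e\<^sub>i x\<close> for restriction idempotents \<open>e\<^sub>i\<close>; apply this to \<open>f\<^sub>i h = \<rho> f\<^sub>i (\<Squnion>f\<^sub>i) h\<close>.
  Moreover \<open>f \<circledast> g\<close> is the least \<open>h\<close> with \<open>g \<le> h\<close> and \<open>f h \<le> h\<close>, which yields lax uniformity and,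
  with right distributivity, the law for \<open>(f \<squnion> f') \<circledast> g\<close>; dinaturality and colax uniformity
  compare the powers termwise.
\<close>

section \<open>Powers of an endomorphism\<close>

context category
begin

lemma hom_Obj: "f \<in> hom C A B \<Longrightarrow> A \<in> Obj C" "f \<in> hom C A B \<Longrightarrow> B \<in> Obj C"
  using Dom_in_Obj Cod_in_Obj by (auto simp: hom_def)

lemma iter_in_hom: "f \<in> hom C P P \<Longrightarrow> iter C f n \<in> hom C P P"
proof (induction n)
  case 0
  then show ?case using Id_in_hom hom_Obj by (auto simp: hom_def)
next
  case (Suc n)
  then show ?case using Comp_in_hom by auto
qed

lemma iter_0_comp: "f \<in> hom C P P \<Longrightarrow> g \<in> hom C P A \<Longrightarrow> iter C f 0 \<Zsemi> g = g"
  using Id_left[of g P A] by (auto simp: hom_def)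

text \<open>Stated with \<open>g\<close> attached because this is the shape of the terms of the
  iteration family.\<close>

lemma iter_Suc_comp:
  "f \<in> hom C P P \<Longrightarrow> g \<in> hom C P A \<Longrightarrow> iter C f (Suc n) \<Zsemi> g = f \<Zsemi> (iter C f n \<Zsemi> g)"
  using Comp_assoc[of f P P "iter C f n" P g A] iter_in_hom by simp

lemma iter_add_comp:
  assumes f: "f \<in> hom C P P" and g: "g \<in> hom C P A"
  shows "iter C f (n + m) \<Zsemi> g = iter C f n \<Zsemi> (iter C f m \<Zsemi> g)"
proof (induction n)
  case 0
  show ?case using iter_0_comp[OF f Comp_in_hom[OF iter_in_hom[OF f] g]] by simp
next
  case (Suc n)
  have m: "iter C f m \<Zsemi> g \<in> hom C P A" by (rule Comp_in_hom[OF iter_in_hom[OF f] g])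
  show ?case using Suc iter_Suc_comp[OF f g] iter_Suc_comp[OF f m] by simp
qed

text \<open>Regrouping brackets: both sides spell the same alternating word in \<open>k\<close> and
  \<open>f\<close>, with \<open>n + 1\<close> letters \<open>k\<close>, followed by
  \<open>g\<close>. This is the dinatural law of the wand before joins are taken.\<close>

lemma iter_dinatural:
  assumes f: "f \<in> hom C P Q" and g: "g \<in> hom C P A" and k: "k \<in> hom C Q P"
  shows "iter C (k \<Zsemi> f) n \<Zsemi> (k \<Zsemi> g) = k \<Zsemi> (iter C (f \<Zsemi> k) n \<Zsemi> g)"
proof (induction n)
  case 0
  show ?case
    using iter_0_comp[OF Comp_in_hom[OF k f] Comp_in_hom[OF k g]] iter_0_comp[OF Comp_in_hom[OF f k] g]
    by simp
next
  case (Suc n)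
  have kf: "k \<Zsemi> f \<in> hom C Q Q" and fk: "f \<Zsemi> k \<in> hom C P P" and kg: "k \<Zsemi> g \<in> hom C Q A"
    using Comp_in_hom f g k by blast+
  have i: "iter C (f \<Zsemi> k) n \<Zsemi> g \<in> hom C P A"
    by (rule Comp_in_hom[OF iter_in_hom[OF fk] g])
  show ?case
    using Suc iter_Suc_comp[OF kf kg] iter_Suc_comp[OF fk g] Comp_assoc[OF k f Comp_in_hom[OF k i]]
      Comp_assoc[OF f k i] by simp
qed

end

section \<open>The order on maps and least upper bounds\<close>

context restriction_category
begin

lemma leI: "f \<in> hom C A B \<Longrightarrow> g \<in> hom C A B \<Longrightarrow> \<rho> f \<Zsemi> g = f \<Longrightarrow> f \<sqsubseteq> g"
  by (auto simp: le_def hom_def)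

lemma leD: "f \<sqsubseteq> g \<Longrightarrow> \<rho> f \<Zsemi> g = f"
  by (simp add: le_def)

lemma le_hom_iff: "f \<sqsubseteq> g \<Longrightarrow> f \<in> hom C A B \<longleftrightarrow> g \<in> hom C A B"
  by (auto simp: le_def hom_def)

lemma le_homE:
  assumes "f \<sqsubseteq> g"
  obtains A B where "f \<in> hom C A B" "g \<in> hom C A B"
  using assms by (auto simp: le_def hom_def)

lemma restr_Id:
  assumes "A \<in> Obj C" shows "\<rho> (Id C A) = Id C A"
  using restr_comp[OF Id_in_hom[OF assms]] Id_right[OF restr_in_hom[OF Id_in_hom[OF assms]]] by simp

lemma restr_restr: "f \<in> hom C A B \<Longrightarrow> \<rho> (\<rho> f) = \<rho> f"
  using restr_restr_comp[OF Id_in_hom[OF hom_Obj(1)], of f A B f B] restr_Id[OF hom_Obj(1)]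
    Id_right[OF restr_in_hom, of f A B] by simp

lemma le_refl: "f \<in> hom C A B \<Longrightarrow> f \<sqsubseteq> f"
  using leI restr_comp by blast

lemma le_restr:
  assumes "f \<sqsubseteq> g" shows "\<rho> f \<sqsubseteq> \<rho> g"
proof -
  obtain A B where h: "f \<in> hom C A B" "g \<in> hom C A B" using assms le_homE by blast
  \<comment> \<open>Apply \<open>\<rho>\<close> to \<open>f = \<rho> f \<Zsemi> g\<close>.\<close>
  have "\<rho> f \<Zsemi> \<rho> g = \<rho> f" using restr_restr_comp[OF h(2,1)] leD[OF assms] by simp
  then show ?thesis using leI[of "\<rho> f" A A "\<rho> g"] restr_in_hom h restr_restr by simp
qed

lemma le_trans:
  assumes "f \<sqsubseteq> g" "g \<sqsubseteq> h" shows "f \<sqsubseteq> h"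
proof -
  obtain A B where fg: "f \<in> hom C A B" "g \<in> hom C A B" using assms le_homE by blast
  have h: "h \<in> hom C A B" using fg le_hom_iff[OF assms(2)] by blast
  have 1: "\<rho> f \<Zsemi> \<rho> g = \<rho> f"
    using restr_restr_comp[OF fg(2,1)] leD[OF assms(1)] by simp
  have "\<rho> f \<Zsemi> h = \<rho> f \<Zsemi> \<rho> g \<Zsemi> h" using 1 by simp
  also have "\<dots> = \<rho> f \<Zsemi> (\<rho> g \<Zsemi> h)"
    using Comp_assoc[OF restr_in_hom[OF fg(1)] restr_in_hom[OF fg(2)] h] .
  also have "\<dots> = f" using leD assms by simp
  finally show ?thesis using leI fg h by blast
qed

text \<open>A map below \<open>g\<close> is \<open>g\<close> cut down by its own restriction
  idempotent, so only the idempotents remain to be compared. Antisymmetry rests on this, and so does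
  the identification of the join in \<open>is_join_restr_comp\<close>.\<close>

lemma le_restr_eq:
  assumes "f \<sqsubseteq> g" "\<rho> f = \<rho> g" shows "f = g"
proof -
  obtain A B where "g \<in> hom C A B" using assms le_homE by blast
  then show ?thesis using leD[OF assms(1)] assms(2) restr_comp by simp
qed

lemma restr_antisym:
  assumes "f \<in> hom C A B" "g \<in> hom C A D" "\<rho> f \<sqsubseteq> \<rho> g" "\<rho> g \<sqsubseteq> \<rho> f" shows "\<rho> f = \<rho> g"
  using leD[OF assms(3)] leD[OF assms(4)] restr_restr assms(1,2) restr_commute[OF assms(1,2)] by simp

lemma le_antisym:
  assumes "f \<sqsubseteq> g" "g \<sqsubseteq> f" shows "f = g"
proof -
  obtain A B where "f \<in> hom C A B" "g \<in> hom C A B" using assms le_homE by blast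
  then show ?thesis using le_restr_eq restr_antisym le_restr assms by blast
qed

text \<open>The axiom \<open>comp_restr\<close> moves \<open>h\<close> past a restriction,
  \<open>\<rho> (h \<Zsemi> g) \<Zsemi> h = h \<Zsemi> \<rho> g\<close>, after which
  \<open>\<rho> g \<Zsemi> g' = g\<close> finishes.\<close>

lemma comp_mono_right:
  assumes le: "g \<sqsubseteq> g'" and h: "h \<in> hom C A B" and g: "g \<in> hom C B D"
  shows "h \<Zsemi> g \<sqsubseteq> h \<Zsemi> g'"
proof -
  have g': "g' \<in> hom C B D" using le g le_hom_iff by blast
  have "\<rho> (h \<Zsemi> g) \<Zsemi> (h \<Zsemi> g') = \<rho> (h \<Zsemi> g) \<Zsemi> h \<Zsemi> g'"
    using Comp_assoc[OF restr_in_hom[OF Comp_in_hom[OF h g]] h g'] by simp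
  also have "\<dots> = h \<Zsemi> \<rho> g \<Zsemi> g'" using comp_restr[OF h g] by simp
  also have "\<dots> = h \<Zsemi> g" using Comp_assoc[OF h restr_in_hom[OF g] g'] leD[OF le] by simp
  finally show ?thesis using leI Comp_in_hom h g g' by blast
qed

lemma comp_mono_left:
  assumes le: "f \<sqsubseteq> f'" and f: "f \<in> hom C A B" and h: "h \<in> hom C B D"
  shows "f \<Zsemi> h \<sqsubseteq> f' \<Zsemi> h"
proof -
  have f': "f' \<in> hom C A B" using le f le_hom_iff by blast
  note f'h = Comp_in_hom[OF f' h]
  have eq: "f \<Zsemi> h = \<rho> f \<Zsemi> (f' \<Zsemi> h)"
    using Comp_assoc[OF restr_in_hom[OF f] f' h] leD[OF le] by simp
  have "\<rho> (f \<Zsemi> h) \<Zsemi> (f' \<Zsemi> h) = \<rho> f \<Zsemi> \<rho> (f' \<Zsemi> h) \<Zsemi> (f' \<Zsemi> h)"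
    using eq restr_restr_comp[OF f'h f] by simp
  also have "\<dots> = f \<Zsemi> h"
    using Comp_assoc[OF restr_in_hom[OF f] restr_in_hom[OF f'h] f'h] restr_comp[OF f'h] eq by simp
  finally show ?thesis using leI Comp_in_hom f h f' by blast
qed

lemma restr_comp_le:
  assumes f: "f \<in> hom C A B" and g: "g \<in> hom C A D"
  shows "\<rho> f \<Zsemi> g \<sqsubseteq> g"
proof (rule leI[OF Comp_in_hom[OF restr_in_hom[OF f] g] g])
  show "\<rho> (\<rho> f \<Zsemi> g) \<Zsemi> g = \<rho> f \<Zsemi> g"
    using restr_restr_comp[OF g f] Comp_assoc[OF restr_in_hom[OF f] restr_in_hom[OF g] g]
      restr_comp[OF g] by simp
qed

lemma is_join_in_hom: "is_join C A B I f u \<Longrightarrow> u \<in> hom C A B"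
  by (simp add: is_join_def)

lemma is_join_upper: "is_join C A B I f u \<Longrightarrow> i \<in> I \<Longrightarrow> f i \<sqsubseteq> u"
  by (simp add: is_join_def)

lemma is_join_least:
  "is_join C A B I f u \<Longrightarrow> v \<in> hom C A B \<Longrightarrow> (\<And>i. i \<in> I \<Longrightarrow> f i \<sqsubseteq> v) \<Longrightarrow> u \<sqsubseteq> v"
  by (simp add: is_join_def)

lemma is_join_unique: "is_join C A B I f u \<Longrightarrow> is_join C A B I f v \<Longrightarrow> u = v"
  unfolding is_join_def by (blast intro: le_antisym)

lemma Join_eq: "is_join C A B I f u \<Longrightarrow> Join C A B I f = u"
  unfolding Join_def by (blast intro: the_equality is_join_unique)

text \<open>Binary joins are encoded as joins of families over \<open>bool\<close>; this unfolds the
  encoding once.\<close>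

lemma is_join_pair_iff:
  "is_join C A B UNIV (\<lambda>b. if b then f else g) u \<longleftrightarrow> u \<in> hom C A B \<and> f \<sqsubseteq> u \<and> g \<sqsubseteq> u \<and>
    (\<forall>v\<in>hom C A B. f \<sqsubseteq> v \<longrightarrow> g \<sqsubseteq> v \<longrightarrow> u \<sqsubseteq> v)"
  by (auto simp: is_join_def all_bool_eq)

end

section \<open>Disjointness of powers and of derived families\<close>

context perp_restriction_category
begin

lemma perp_comp_left:
  assumes f: "f \<in> hom C A B" and g: "g \<in> hom C A D" and "f \<bottom> g" and h: "h \<in> hom C A' A"
  shows "h \<Zsemi> f \<bottom> h \<Zsemi> g"
  using perp_comp[OF assms Id_in_hom Id_in_hom, OF hom_Obj(2)[OF f] hom_Obj(2)[OF g]]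
    Id_right[OF Comp_in_hom[OF h f]] Id_right[OF Comp_in_hom[OF h g]] by simp

lemma perp_comp_right:
  assumes f: "f \<in> hom C A B" and g: "g \<in> hom C A D" and p: "f \<bottom> g"
    and k: "k \<in> hom C B B'" "k' \<in> hom C D D'"
  shows "f \<Zsemi> k \<bottom> g \<Zsemi> k'"
  using perp_comp[OF f g p Id_in_hom k] Id_left[OF f] Id_left[OF g] hom_Obj(1)[OF f] by simp

lemma perp_comp_right1:
  assumes f: "f \<in> hom C A B" and g: "g \<in> hom C A D" and p: "f \<bottom> g" and k: "k \<in> hom C D D'"
  shows "f \<bottom> g \<Zsemi> k"
  using perp_comp_right[OF f g p Id_in_hom k] Id_right[OF f] hom_Obj[OF f] by simp

text \<open>The common prefix \<open>iter C f n\<close> can be stripped, which leaves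
  \<open>g\<close> against \<open>f \<Zsemi> (iter C f k \<Zsemi> g')\<close>; these are disjoint
  because \<open>g\<close> and \<open>f\<close> are and disjointness survives postcomposition. The
  exit map \<open>g'\<close> is kept separate from \<open>g\<close> for comparing two iterations of
  the same \<open>f\<close>.\<close>

lemma perp_iter:
  assumes f: "f \<in> hom C P P" and g: "g \<in> hom C P A" and g': "g' \<in> hom C P B"
    and "f \<bottom> g" and "n < m"
  shows "iter C f n \<Zsemi> g \<bottom> iter C f m \<Zsemi> g'"
proof -
  obtain k where m: "m = n + Suc k" using less_imp_Suc_add[OF \<open>n < m\<close>] by auto
  have kg: "iter C f k \<Zsemi> g' \<in> hom C P B" by (rule Comp_in_hom[OF iter_in_hom[OF f] g'])
  have "g \<bottom> f \<Zsemi> (iter C f k \<Zsemi> g')"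
    using perp_comp_right1[OF g f perp_sym[OF \<open>f \<bottom> g\<close>] kg] .
  then show ?thesis
    unfolding m iter_add_comp[OF f g'] iter_Suc_comp[OF f g']
    by (rule perp_comp_left[OF g Comp_in_hom[OF f kg] _ iter_in_hom[OF f]])
qed

lemma disj_family_iter:
  assumes f: "f \<in> hom C P P" and g: "g \<in> hom C P A" and "f \<bottom> g"
  shows "disj_family C P A (UNIV :: nat set) (\<lambda>n. iter C f n \<Zsemi> g)"
proof -
  have "iter C f n \<Zsemi> g \<bottom> iter C f m \<Zsemi> g" if "n \<noteq> m" for n m
    using linorder_neqE_nat[OF that] perp_iter[OF f g g \<open>f \<bottom> g\<close>]
      perp_sym[OF perp_iter[OF f g g \<open>f \<bottom> g\<close>]] by blast
  then show ?thesis
    using hom_Obj[OF g] Comp_in_hom[OF iter_in_hom[OF f] g] by (simp add: disj_family_def)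
qed

lemma disj_family_restr:
  assumes "disj_family C A B I f" shows "disj_family C A A I (\<lambda>i. \<rho> (f i))"
  using assms restr_in_hom perp_restr unfolding disj_family_def by blast

lemma disj_family_comp_left:
  assumes "disj_family C A B I f" "h \<in> hom C A' A"
  shows "disj_family C A' B I (\<lambda>i. h \<Zsemi> f i)"
  using assms(1) hom_Obj(1)[OF assms(2)] Comp_in_hom[OF assms(2), of _ B]
    perp_comp_left[OF _ _ _ assms(2), of _ B _ B]
  by (simp add: disj_family_def)

lemma disj_family_comp_right:
  assumes "disj_family C A B I f" "h \<in> hom C B D"
  shows "disj_family C A D I (\<lambda>i. f i \<Zsemi> h)"
  using assms(1) hom_Obj(2)[OF assms(2)] Comp_in_hom[OF _ assms(2), of _ A]
    perp_comp_right[OF _ _ _ assms(2) assms(2), of _ A]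
  by (simp add: disj_family_def)

lemma disj_family_pair:
  assumes "f \<in> hom C A B" "g \<in> hom C A B" "f \<bottom> g"
  shows "disj_family C A B UNIV (\<lambda>b. if b then f else g)"
  using assms hom_Obj[OF assms(1)] perp_sym[OF assms(3)] by (auto simp: disj_family_def)

lemma uniform_if_lax_colax:
  assumes lax: "lax_uniform C w" and colax: "colax_uniform C w"
  shows "uniform C w"
  unfolding uniform_def
proof (intro allI ballI impI)
  fix P Q A f g f' g' h
  assume f: "f \<in> hom C P P" and g: "g \<in> hom C P A" and f': "f' \<in> hom C Q Q" and g': "g' \<in> hom C Q A"
    and h: "h \<in> hom C P Q" and p: "f \<bottom> g" and p': "f' \<bottom> g'"
    and gh: "h \<Zsemi> g' = g" and fh: "h \<Zsemi> f' = f \<Zsemi> h"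
  have le: "g \<sqsubseteq> h \<Zsemi> g'" "h \<Zsemi> g' \<sqsubseteq> g" "f \<Zsemi> h \<sqsubseteq> h \<Zsemi> f'" "h \<Zsemi> f' \<sqsubseteq> f \<Zsemi> h"
    using le_refl[OF g] le_refl[OF Comp_in_hom[OF f h]] gh fh by simp_all
  have "w f g \<sqsubseteq> h \<Zsemi> w f' g'"
    using lax[unfolded lax_uniform_def, rule_format, OF f g f' g' h p p' le(1,3)] .
  moreover have "h \<Zsemi> w f' g' \<sqsubseteq> w f g"
    using colax[unfolded colax_uniform_def, rule_format, OF f g f' g' h p p' le(2,4)] .
  ultimately show "h \<Zsemi> w f' g' = w f g" using le_antisym by blast
qed

end

section \<open>Joins under composition and restriction\<close>

context disjoint_perp_restriction_category
begin

lemma Join_is_join: "disj_family C A B I f \<Longrightarrow> is_join C A B I f (Join C A B I f)"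
  using joins_over_any[of I, unfolded has_joins_over_def] Join_eq by fastforce

text \<open>The distributivity hypothesis equates chosen joins \<open>Join\<close>, which carry
  information only once a join exists; disjointness of the composed family supplies it and turns the
  equation into a universal property.\<close>

lemma is_join_comp_left:
  assumes d: "disj_family C A B I f" and j: "is_join C A B I f u" and h: "h \<in> hom C A' A"
  shows "is_join C A' B I (\<lambda>i. h \<Zsemi> f i) (h \<Zsemi> u)"
proof -
  have "h \<Zsemi> u = Join C A' B I (\<lambda>i. h \<Zsemi> f i)"
    using joins_over_any[of I, unfolded has_joins_over_def] d h Join_eq[OF j] by auto
  then show ?thesis using Join_is_join[OF disj_family_comp_left[OF d h]] by simp
qed

lemma perp_is_join:
  assumes "disj_family C A B I f" "is_join C A B I f u" "h \<in> hom C A D" "\<And>i. i \<in> I \<Longrightarrow> f i \<bottom> h"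
  shows "u \<bottom> h"
  using strong_joins_over_any[of I] assms Join_eq[OF assms(2)]
  unfolding strong_joins_over_def by blast

text \<open>Let \<open>e\<close> be the join of the \<open>\<rho> (f i)\<close>; it lies below
  \<open>\<rho> u\<close>. Cutting \<open>u\<close> down by \<open>e\<close> loses none of the
  \<open>f i\<close>, hence nothing of \<open>u\<close>, so \<open>\<rho> u\<close> cannot exceed
  \<open>e\<close>.\<close>

lemma is_join_restr:
  assumes d: "disj_family C A B I f" and j: "is_join C A B I f u"
  shows "is_join C A A I (\<lambda>i. \<rho> (f i)) (\<rho> u)"
proof -
  define e where "e = Join C A A I (\<lambda>i. \<rho> (f i))"
  have e: "is_join C A A I (\<lambda>i. \<rho> (f i)) e"
    unfolding e_def by (rule Join_is_join[OF disj_family_restr[OF d]])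
  note u = is_join_in_hom[OF j] and eh = is_join_in_hom[OF e]
  have fi: "f i \<in> hom C A B" if "i \<in> I" for i using d that by (simp add: disj_family_def)
  have le: "e \<sqsubseteq> \<rho> u"
    using is_join_least[OF e restr_in_hom[OF u]] le_restr is_join_upper[OF j] by blast
  have A: "A \<in> Obj C" using hom_Obj u by blast
  have "\<rho> u \<sqsubseteq> Id C A"
    using leI[OF restr_in_hom[OF u] Id_in_hom[OF A]] restr_restr[OF u] Id_right[OF restr_in_hom[OF u]]
    by simp
  then have "e \<sqsubseteq> Id C A" using le le_trans by blast
  \<comment> \<open>Being below the identity means \<open>\<rho> e \<Zsemi> Id C A = e\<close>, so
    \<open>e\<close> is a restriction idempotent.\<close>
  then have re: "\<rho> e = e" using leD[of e "Id C A"] Id_right[OF restr_in_hom[OF eh]] by simp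
  have "f i \<sqsubseteq> e \<Zsemi> u" if i: "i \<in> I" for i
    using comp_mono_left[OF is_join_upper[OF e i] restr_in_hom[OF fi[OF i]] u]
      leD[OF is_join_upper[OF j i]] by simp
  then have "u \<sqsubseteq> e \<Zsemi> u" by (rule is_join_least[OF j Comp_in_hom[OF eh u]])
  moreover have "e \<Zsemi> u \<sqsubseteq> u" using restr_comp_le[OF eh u] re by simp
  ultimately have "e \<Zsemi> u = u" using le_antisym by blast
  \<comment> \<open>Apply \<open>\<rho>\<close> to \<open>e \<Zsemi> u = u\<close>; on the other
    hand \<open>e \<sqsubseteq> \<rho> u\<close> says that the same product is
    \<open>e\<close>.\<close>
  then have "\<rho> u = e \<Zsemi> \<rho> u" using restr_restr_comp[OF u eh] re by simp
  then have "\<rho> u = e" using leD[OF le] re by simp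
  then show ?thesis using e by simp
qed

text \<open>Distributivity is given for maps in front, while \<open>x\<close> stands behind. For
  restrictions the side does not matter: \<open>\<rho> (\<rho> (f i) \<Zsemi> x)\<close> is the
  product of two commuting idempotents. As \<open>w\<close> lies below
  \<open>\<rho> u \<Zsemi> x\<close>, equality of restrictions suffices.\<close>

lemma is_join_restr_comp:
  assumes d: "disj_family C A B I f" and j: "is_join C A B I f u" and x: "x \<in> hom C A D"
  shows "is_join C A D I (\<lambda>i. \<rho> (f i) \<Zsemi> x) (\<rho> u \<Zsemi> x)"
proof -
  define w where "w = Join C A D I (\<lambda>i. \<rho> (f i) \<Zsemi> x)"
  have d': "disj_family C A D I (\<lambda>i. \<rho> (f i) \<Zsemi> x)"
    by (rule disj_family_comp_right[OF disj_family_restr[OF d] x])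
  have w: "is_join C A D I (\<lambda>i. \<rho> (f i) \<Zsemi> x) w"
    unfolding w_def by (rule Join_is_join[OF d'])
  note u = is_join_in_hom[OF j]
  have fi: "f i \<in> hom C A B" if "i \<in> I" for i using d that by (simp add: disj_family_def)
  have "\<rho> (f i) \<Zsemi> x \<sqsubseteq> \<rho> u \<Zsemi> x" if "i \<in> I" for i
    using comp_mono_left[OF le_restr[OF is_join_upper[OF j that]] restr_in_hom[OF fi[OF that]] x] .
  then have wle: "w \<sqsubseteq> \<rho> u \<Zsemi> x"
    by (rule is_join_least[OF w Comp_in_hom[OF restr_in_hom[OF u] x]])
  \<comment> \<open>Here \<open>\<rho> x\<close> is the map in front of the join of the
    \<open>\<rho> (f i)\<close>.\<close>
  have "is_join C A A I (\<lambda>i. \<rho> x \<Zsemi> \<rho> (f i)) (\<rho> x \<Zsemi> \<rho> u)"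
    by (rule is_join_comp_left[OF disj_family_restr[OF d] is_join_restr[OF d j] restr_in_hom[OF x]])
  moreover have "\<rho> x \<Zsemi> \<rho> (f i) \<sqsubseteq> \<rho> w" if "i \<in> I" for i
    using le_restr[OF is_join_upper[OF w that]] restr_restr_comp[OF x fi[OF that]]
      restr_commute[OF x fi[OF that]] by simp
  ultimately have "\<rho> x \<Zsemi> \<rho> u \<sqsubseteq> \<rho> w"
    by (rule is_join_least[OF _ restr_in_hom[OF is_join_in_hom[OF w]]])
  then have "\<rho> (\<rho> u \<Zsemi> x) \<sqsubseteq> \<rho> w"
    using restr_restr_comp[OF x u] restr_commute[OF x u] by simp
  then have "\<rho> w = \<rho> (\<rho> u \<Zsemi> x)"
    using restr_antisym[OF is_join_in_hom[OF w] Comp_in_hom[OF restr_in_hom[OF u] x] le_restr[OF wle]]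
    by blast
  then have "w = \<rho> u \<Zsemi> x" by (rule le_restr_eq[OF wle])
  then show ?thesis using w by simp
qed

lemma is_join_comp_right:
  assumes d: "disj_family C A B I f" and j: "is_join C A B I f u" and h: "h \<in> hom C B D"
  shows "is_join C A D I (\<lambda>i. f i \<Zsemi> h) (u \<Zsemi> h)"
proof -
  note u = is_join_in_hom[OF j]
  have fi: "f i \<in> hom C A B" if "i \<in> I" for i using d that by (simp add: disj_family_def)
  have "\<rho> (f i) \<Zsemi> (u \<Zsemi> h) = f i \<Zsemi> h" if "i \<in> I" for i
    using Comp_assoc[OF restr_in_hom[OF fi[OF that]] u h] leD[OF is_join_upper[OF j that]] by simp
  moreover have "\<rho> u \<Zsemi> (u \<Zsemi> h) = u \<Zsemi> h"
    using Comp_assoc[OF restr_in_hom[OF u] u h] restr_comp[OF u] by simp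
  ultimately show ?thesis
    using is_join_restr_comp[OF d j Comp_in_hom[OF u h]] by (simp add: is_join_def)
qed

lemma is_join_join2:
  assumes "f \<in> hom C A B" "g \<in> hom C A B" "f \<bottom> g"
  shows "is_join C A B UNIV (\<lambda>b. if b then f else g) (f \<squnion> g)"
  using Join_is_join[OF disj_family_pair[OF assms]] assms(1) by (simp add: join2_def hom_def)

section \<open>The iteration formula as a least pre-fixed point\<close>

lemma is_join_iter_wand:
  assumes "f \<in> hom C P P" "g \<in> hom C P A" "f \<bottom> g"
  shows "is_join C P A UNIV (\<lambda>n. iter C f n \<Zsemi> g) (iter_wand C f g)"
  using Join_is_join[OF disj_family_iter[OF assms]] assms(2) by (simp add: iter_wand_def hom_def)

lemma iter_wand_in_hom:
  "f \<in> hom C P P \<Longrightarrow> g \<in> hom C P A \<Longrightarrow> f \<bottom> g \<Longrightarrow> iter_wand C f g \<in> hom C P A"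
  by (rule is_join_in_hom[OF is_join_iter_wand])

text \<open>Every term is bounded by induction on the exponent. With \<open>le_iter_wand\<close> and
  \<open>comp_iter_wand_le\<close> this gives the least pre-fixed point property, the form in which
  iteration enters the diagonal law and lax uniformity.\<close>

lemma iter_wand_induct:
  assumes f: "f \<in> hom C P P" and g: "g \<in> hom C P A" and p: "f \<bottom> g"
    and fh: "f \<Zsemi> h \<sqsubseteq> h" and gh: "g \<sqsubseteq> h"
  shows "iter_wand C f g \<sqsubseteq> h"
proof (rule is_join_least[OF is_join_iter_wand[OF f g p]])
  show "h \<in> hom C P A" using g le_hom_iff[OF gh] by blast
  fix n :: nat
  show "iter C f n \<Zsemi> g \<sqsubseteq> h"
  proof (induction n)
    case 0
    show ?case using iter_0_comp[OF f g] gh by simp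
  next
    case (Suc n)
    have "f \<Zsemi> (iter C f n \<Zsemi> g) \<sqsubseteq> f \<Zsemi> h"
      by (rule comp_mono_right[OF Suc f Comp_in_hom[OF iter_in_hom[OF f] g]])
    then show ?case unfolding iter_Suc_comp[OF f g] using fh by (rule le_trans)
  qed
qed

lemma le_iter_wand:
  assumes "f \<in> hom C P P" "g \<in> hom C P A" "f \<bottom> g" shows "g \<sqsubseteq> iter_wand C f g"
  using is_join_upper[OF is_join_iter_wand[OF assms], of 0] iter_0_comp assms by fastforce

text \<open>Left distributivity shifts the index: \<open>f\<close> in front yields the tail of the
  family, starting at exponent 1.\<close>

lemma is_join_comp_iter_wand:
  assumes f: "f \<in> hom C P P" and g: "g \<in> hom C P A" and p: "f \<bottom> g"
  shows "is_join C P A UNIV (\<lambda>n. iter C f (Suc n) \<Zsemi> g) (f \<Zsemi> iter_wand C f g)"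
  using is_join_comp_left[OF disj_family_iter[OF f g p] is_join_iter_wand[OF f g p] f]
  \<comment> \<open>\<open>iter.simps\<close> is removed so that \<open>Suc n\<close> stays folded
    and \<open>iter_Suc_comp\<close> can match.\<close>
  by (simp add: iter_Suc_comp[OF f g] del: iter.simps)

lemma comp_iter_wand_le:
  assumes "f \<in> hom C P P" "g \<in> hom C P A" "f \<bottom> g"
  shows "f \<Zsemi> iter_wand C f g \<sqsubseteq> iter_wand C f g"
  by (rule is_join_least[OF is_join_comp_iter_wand[OF assms] iter_wand_in_hom[OF assms]])
    (rule is_join_upper[OF is_join_iter_wand[OF assms] UNIV_I])

text \<open>The family splits into its term at exponent 0, which is \<open>g\<close>, and its tail,
  whose join is the second component. Besides the unfolding law this serves to decompose
  \<open>R\<close> in the diagonal law.\<close>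

lemma iter_wand_is_pair_join:
  assumes f: "f \<in> hom C P P" and g: "g \<in> hom C P A" and p: "f \<bottom> g"
  shows "is_join C P A UNIV (\<lambda>b. if b then g else f \<Zsemi> iter_wand C f g) (iter_wand C f g)"
  unfolding is_join_pair_iff
proof (intro conjI ballI impI)
  show "iter_wand C f g \<in> hom C P A" "g \<sqsubseteq> iter_wand C f g" "f \<Zsemi> iter_wand C f g \<sqsubseteq> iter_wand C f g"
    using iter_wand_in_hom[OF assms] le_iter_wand[OF assms] comp_iter_wand_le[OF assms] .
  fix v assume v: "v \<in> hom C P A" "g \<sqsubseteq> v" "f \<Zsemi> iter_wand C f g \<sqsubseteq> v"
  have "iter C f n \<Zsemi> g \<sqsubseteq> v" for n
  proof (cases n)
    case 0
    then show ?thesis using v iter_0_comp[OF f g] by simp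
  next
    case (Suc m)
    then show ?thesis
      using is_join_upper[OF is_join_comp_iter_wand[OF assms], of m] v le_trans by blast
  qed
  then show "iter_wand C f g \<sqsubseteq> v" using is_join_least[OF is_join_iter_wand[OF assms] v(1)] by blast
qed

section \<open>The axioms of a Kleene wand\<close>

lemma iter_wand_unfold:
  assumes "f \<in> hom C P P" "g \<in> hom C P A" "f \<bottom> g"
  shows "g \<squnion> (f \<Zsemi> iter_wand C f g) = iter_wand C f g"
  using Join_eq[OF iter_wand_is_pair_join[OF assms]] assms(2) by (simp add: join2_def hom_def)

lemma iter_wand_comp:
  assumes f: "f \<in> hom C P P" and g: "g \<in> hom C P A" and p: "f \<bottom> g" and h: "h \<in> hom C A B"
  shows "iter_wand C f g \<Zsemi> h = iter_wand C f (g \<Zsemi> h)"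
proof (rule is_join_unique)
  show "is_join C P B UNIV (\<lambda>n. iter C f n \<Zsemi> (g \<Zsemi> h)) (iter_wand C f g \<Zsemi> h)"
    using is_join_comp_right[OF disj_family_iter[OF f g p] is_join_iter_wand[OF f g p] h]
    by (simp add: Comp_assoc[OF iter_in_hom[OF f] g h])
  show "is_join C P B UNIV (\<lambda>n. iter C f n \<Zsemi> (g \<Zsemi> h)) (iter_wand C f (g \<Zsemi> h))"
    by (rule is_join_iter_wand[OF f Comp_in_hom[OF g h] perp_comp_right1[OF f g p h]])
qed

text \<open>By left distributivity and \<open>iter_dinatural\<close> both sides are joins of the
  same family.\<close>

lemma iter_wand_dinatural:
  assumes f: "f \<in> hom C P Q" and g: "g \<in> hom C P A" and k: "k \<in> hom C Q P" and p: "f \<bottom> g"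
  shows "iter_wand C (k \<Zsemi> f) (k \<Zsemi> g) = k \<Zsemi> iter_wand C (f \<Zsemi> k) g"
proof (rule is_join_unique)
  note fk = Comp_in_hom[OF f k]
  have p': "f \<Zsemi> k \<bottom> g" using perp_sym[OF perp_comp_right1[OF g f perp_sym[OF p] k]] .
  show "is_join C Q A UNIV (\<lambda>n. iter C (k \<Zsemi> f) n \<Zsemi> (k \<Zsemi> g)) (iter_wand C (k \<Zsemi> f) (k \<Zsemi> g))"
    by (rule is_join_iter_wand[OF Comp_in_hom[OF k f] Comp_in_hom[OF k g] perp_comp_left[OF f g p k]])
  show "is_join C Q A UNIV (\<lambda>n. iter C (k \<Zsemi> f) n \<Zsemi> (k \<Zsemi> g)) (k \<Zsemi> iter_wand C (f \<Zsemi> k) g)"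
    using is_join_comp_left[OF disj_family_iter[OF fk g p'] is_join_iter_wand[OF fk g p'] k]
    by (simp add: iter_dinatural[OF f g k])
qed

text \<open>Strength of joins lifts termwise disjointness to the joins, once in each argument. For
  different exponents the term that exits earlier is disjoint from the other because its exit map is
  disjoint from \<open>f\<close>; for equal exponents \<open>g \<bottom> g'\<close> decides.\<close>

lemma iter_wand_perp:
  assumes f: "f \<in> hom C P P" and g: "g \<in> hom C P A" and g': "g' \<in> hom C P B"
    and p: "f \<bottom> g" "f \<bottom> g'" "g \<bottom> g'"
  shows "iter_wand C f g \<bottom> iter_wand C f g'"
proof (rule perp_is_join[OF disj_family_iter[OF f g p(1)] is_join_iter_wand[OF f g p(1)]
      iter_wand_in_hom[OF f g' p(2)]])
  fix n :: nat
  have ng: "iter C f n \<Zsemi> g \<in> hom C P A" by (rule Comp_in_hom[OF iter_in_hom[OF f] g])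
  \<comment> \<open>Symmetry puts the second join on the left, where strength is stated.\<close>
  have "iter_wand C f g' \<bottom> iter C f n \<Zsemi> g"
  proof (rule perp_is_join[OF disj_family_iter[OF f g' p(2)] is_join_iter_wand[OF f g' p(2)] ng])
    fix m :: nat
    consider "m < n" | "m = n" | "n < m" by linarith
    then show "iter C f m \<Zsemi> g' \<bottom> iter C f n \<Zsemi> g"
    proof cases
      case 1
      then show ?thesis by (rule perp_iter[OF f g' g p(2)])
    next
      case 2
      then show ?thesis using perp_comp_left[OF g' g perp_sym[OF p(3)] iter_in_hom[OF f]] by simp
    next
      case 3
      then show ?thesis by (rule perp_sym[OF perp_iter[OF f g g' p(1)]])
    qed
  qed
  then show "iter C f n \<Zsemi> g \<bottom> iter_wand C f g'" by (rule perp_sym)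
qed

text \<open>The sides \<open>L\<close> and \<open>R\<close> are least pre-fixed points, so each
  inequality reduces to closure conditions on the other side. Here \<open>a\<close> collects the
  runs of \<open>f\<close> that end with one \<open>f'\<close>, and \<open>b\<close> those that end
  with \<open>g\<close>.\<close>

lemma iter_wand_diag:
  assumes f: "f \<in> hom C P P" and f': "f' \<in> hom C P P" and g: "g \<in> hom C P A"
    and ff': "f \<bottom> f'" and sg: "(f \<squnion> f') \<bottom> g"
  shows "iter_wand C f f' \<bottom> iter_wand C f g"
    and "iter_wand C (f \<squnion> f') g = iter_wand C (iter_wand C f f') (iter_wand C f g)"
proof -
  define s a b where "s = f \<squnion> f'" and "a = iter_wand C f f'" and "b = iter_wand C f g"
  have sj: "is_join C P P UNIV (\<lambda>b. if b then f else f') s"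
    unfolding s_def by (rule is_join_join2[OF f f' ff'])
  note s = is_join_in_hom[OF sj]
  have fs: "f \<sqsubseteq> s" "f' \<sqsubseteq> s" using sj by (auto simp: is_join_pair_iff)
  have psg: "s \<bottom> g" using sg by (simp add: s_def)
  have fg: "f \<bottom> g" "f' \<bottom> g" using perp_down[OF psg _ le_refl[OF g]] fs by blast+
  have ab: "a \<bottom> b" unfolding a_def b_def by (rule iter_wand_perp[OF f f' g ff' fg])
  then show "iter_wand C f f' \<bottom> iter_wand C f g" by (simp add: a_def b_def)
  have a: "a \<in> hom C P P" and b: "b \<in> hom C P A"
    using iter_wand_in_hom f f' g ff' fg by (simp_all add: a_def b_def)
  define L R where "L = iter_wand C s g" and "R = iter_wand C a b"
  have L: "L \<in> hom C P A" and R: "R \<in> hom C P A"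
    using iter_wand_in_hom s g psg a b ab by (simp_all add: L_def R_def)
  have sL: "s \<Zsemi> L \<sqsubseteq> L" "g \<sqsubseteq> L"
    unfolding L_def using comp_iter_wand_le[OF s g psg] le_iter_wand[OF s g psg] .
  \<comment> \<open>Closure of \<open>L\<close> under \<open>s\<close> passes to \<open>f\<close>
    and \<open>f'\<close>, which lie below \<open>s\<close>.\<close>
  have fL: "f \<Zsemi> L \<sqsubseteq> L" "f' \<Zsemi> L \<sqsubseteq> L"
    using le_trans[OF comp_mono_left[OF fs(1) f L] sL(1)] le_trans[OF comp_mono_left[OF fs(2) f' L] sL(1)] .
  have "R \<sqsubseteq> L"
    unfolding R_def
  proof (rule iter_wand_induct[OF a b ab])
    show "b \<sqsubseteq> L" unfolding b_def by (rule iter_wand_induct[OF f g fg(1) fL(1) sL(2)])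
    \<comment> \<open>Moving \<open>L\<close> into the exit map turns \<open>a \<Zsemi> L\<close>
      into an iteration of \<open>f\<close>, which induction bounds.\<close>
    have "a \<Zsemi> L = iter_wand C f (f' \<Zsemi> L)" unfolding a_def by (rule iter_wand_comp[OF f f' ff' L])
    also have "\<dots> \<sqsubseteq> L"
      by (rule iter_wand_induct[OF f Comp_in_hom[OF f' L] perp_comp_right1[OF f f' ff' L] fL])
    finally show "a \<Zsemi> L \<sqsubseteq> L" .
  qed
  moreover have "L \<sqsubseteq> R"
    unfolding L_def
  proof (rule iter_wand_induct[OF s g psg])
    have bR: "b \<sqsubseteq> R" and aR: "a \<Zsemi> R \<sqsubseteq> R"
      unfolding R_def using le_iter_wand[OF a b ab] comp_iter_wand_le[OF a b ab] .
    show "g \<sqsubseteq> R" using le_iter_wand[OF f g fg(1)] bR le_trans unfolding b_def by blast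
    \<comment> \<open>\<open>f'\<close> is the term of \<open>a\<close> at exponent 0, so
      \<open>f' \<Zsemi> R\<close> lies below \<open>a \<Zsemi> R\<close>.\<close>
    have f'R: "f' \<Zsemi> R \<sqsubseteq> R"
      using comp_mono_left[OF le_iter_wand[OF f f' ff'] f' R] aR le_trans unfolding a_def by blast
    have fb: "f \<Zsemi> b \<sqsubseteq> R"
      using comp_iter_wand_le[OF f g fg(1)] bR le_trans unfolding b_def by blast
    have "f \<Zsemi> a \<sqsubseteq> a" unfolding a_def by (rule comp_iter_wand_le[OF f f' ff'])
    then have "f \<Zsemi> (a \<Zsemi> R) \<sqsubseteq> a \<Zsemi> R"
      using comp_mono_left[OF _ Comp_in_hom[OF f a] R] Comp_assoc[OF f a R] by simp
    then have faR: "f \<Zsemi> (a \<Zsemi> R) \<sqsubseteq> R" using aR le_trans by blast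
    \<comment> \<open>\<open>R\<close> is the join of \<open>b\<close> and
      \<open>a \<Zsemi> R\<close>; left distributivity reduces
      \<open>f \<Zsemi> R \<sqsubseteq> R\<close> to \<open>fb\<close> and
      \<open>faR\<close>.\<close>
    have bd: "disj_family C P A UNIV (\<lambda>c. if c then b else a \<Zsemi> R)"
      by (rule disj_family_pair[OF b Comp_in_hom[OF a R]
            perp_comp_right1[OF b a perp_sym[OF ab] R]])
    have "is_join C P A UNIV (\<lambda>c. if c then b else a \<Zsemi> R) R"
      unfolding R_def by (rule iter_wand_is_pair_join[OF a b ab])
    then have "is_join C P A UNIV (\<lambda>c. f \<Zsemi> (if c then b else a \<Zsemi> R)) (f \<Zsemi> R)"
      by (rule is_join_comp_left[OF bd _ f])
    then have fR: "f \<Zsemi> R \<sqsubseteq> R" by (rule is_join_least[OF _ R]) (use fb faR in auto)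
    have "is_join C P A UNIV (\<lambda>c. (if c then f else f') \<Zsemi> R) (s \<Zsemi> R)"
      by (rule is_join_comp_right[OF disj_family_pair[OF f f' ff'] sj R])
    then show "s \<Zsemi> R \<sqsubseteq> R" by (rule is_join_least[OF _ R]) (use fR f'R in auto)
  qed
  ultimately have "L = R" using le_antisym by blast
  then show "iter_wand C (f \<squnion> f') g = iter_wand C (iter_wand C f f') (iter_wand C f g)"
    by (simp add: L_def R_def s_def a_def b_def)
qed

section \<open>Uniformity and inductivity\<close>

lemma iter_wand_lax_uniform: "lax_uniform C (iter_wand C)"
  unfolding lax_uniform_def
proof (intro allI ballI impI)
  fix P Q A f g f' g' h
  assume f: "f \<in> hom C P P" and g: "g \<in> hom C P A" and f': "f' \<in> hom C Q Q" and g': "g' \<in> hom C Q A"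
    and h: "h \<in> hom C P Q" and p: "f \<bottom> g" and p': "f' \<bottom> g'"
    and gh: "g \<sqsubseteq> h \<Zsemi> g'" and fh: "f \<Zsemi> h \<sqsubseteq> h \<Zsemi> f'"
  \<comment> \<open>The bound \<open>h \<Zsemi> w\<close> is shown to be pre-fixed for
    \<open>f\<close> and \<open>g\<close>: \<open>f\<close> is carried across \<open>h\<close> to
    \<open>f'\<close>, which \<open>w\<close> absorbs.\<close>
  define w where "w = iter_wand C f' g'"
  have w: "w \<in> hom C Q A" unfolding w_def by (rule iter_wand_in_hom[OF f' g' p'])
  have "h \<Zsemi> g' \<sqsubseteq> h \<Zsemi> w"
    unfolding w_def by (rule comp_mono_right[OF le_iter_wand[OF f' g' p'] h g'])
  then have gw: "g \<sqsubseteq> h \<Zsemi> w" using gh le_trans by blast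
  have "f' \<Zsemi> w \<sqsubseteq> w" unfolding w_def by (rule comp_iter_wand_le[OF f' g' p'])
  then have "h \<Zsemi> (f' \<Zsemi> w) \<sqsubseteq> h \<Zsemi> w" by (rule comp_mono_right[OF _ h Comp_in_hom[OF f' w]])
  moreover have "f \<Zsemi> (h \<Zsemi> w) \<sqsubseteq> h \<Zsemi> (f' \<Zsemi> w)"
    using comp_mono_left[OF fh Comp_in_hom[OF f h] w] Comp_assoc[OF f h w] Comp_assoc[OF h f' w] by simp
  ultimately have "f \<Zsemi> (h \<Zsemi> w) \<sqsubseteq> h \<Zsemi> w" using le_trans by blast
  then show "iter_wand C f g \<sqsubseteq> h \<Zsemi> iter_wand C f' g'"
    using iter_wand_induct[OF f g p _ gw] by (simp add: w_def)
qed

text \<open>Now \<open>h\<close> stands in front of the smaller side, where the least pre-fixed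
  point property of \<open>w\<close> alone gives no bound. So \<open>h\<close> is pushed through
  each power, and left distributivity makes the smaller side the join of these terms.\<close>

lemma iter_wand_colax_uniform: "colax_uniform C (iter_wand C)"
  unfolding colax_uniform_def
proof (intro allI ballI impI)
  fix P Q A f g f' g' h
  assume f: "f \<in> hom C P P" and g: "g \<in> hom C P A" and f': "f' \<in> hom C Q Q" and g': "g' \<in> hom C Q A"
    and h: "h \<in> hom C P Q" and p: "f \<bottom> g" and p': "f' \<bottom> g'"
    and gh: "h \<Zsemi> g' \<sqsubseteq> g" and fh: "h \<Zsemi> f' \<sqsubseteq> f \<Zsemi> h"
  have le: "h \<Zsemi> (iter C f' n \<Zsemi> g') \<sqsubseteq> iter C f n \<Zsemi> g" for n
  proof (induction n)
    case 0
    show ?case using gh iter_0_comp[OF f g] iter_0_comp[OF f' g'] by simp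
  next
    case (Suc n)
    have x: "iter C f' n \<Zsemi> g' \<in> hom C Q A" by (rule Comp_in_hom[OF iter_in_hom[OF f'] g'])
    have "h \<Zsemi> (f' \<Zsemi> (iter C f' n \<Zsemi> g')) \<sqsubseteq> f \<Zsemi> (h \<Zsemi> (iter C f' n \<Zsemi> g'))"
      using comp_mono_left[OF fh Comp_in_hom[OF h f'] x] Comp_assoc[OF f h x] Comp_assoc[OF h f' x]
      by simp
    moreover have "f \<Zsemi> (h \<Zsemi> (iter C f' n \<Zsemi> g')) \<sqsubseteq> f \<Zsemi> (iter C f n \<Zsemi> g)"
      by (rule comp_mono_right[OF Suc f Comp_in_hom[OF h x]])
    ultimately show ?case
      unfolding iter_Suc_comp[OF f g] iter_Suc_comp[OF f' g'] by (rule le_trans)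
  qed
  show "h \<Zsemi> iter_wand C f' g' \<sqsubseteq> iter_wand C f g"
  proof (rule is_join_least[OF is_join_comp_left[OF disj_family_iter[OF f' g' p']
          is_join_iter_wand[OF f' g' p'] h] iter_wand_in_hom[OF f g p]])
    fix n :: nat
    show "h \<Zsemi> (iter C f' n \<Zsemi> g') \<sqsubseteq> iter_wand C f g"
      by (rule le_trans[OF le is_join_upper[OF is_join_iter_wand[OF f g p] UNIV_I]])
  qed
qed

lemma iter_wand_strongly_inductive: "strongly_inductive C (iter_wand C)"
proof -
  have "inductive_wand C (iter_wand C)"
    unfolding inductive_wand_def using iter_wand_induct by blast
  then show ?thesis
    using iter_wand_lax_uniform iter_wand_colax_uniform uniform_if_lax_colax
    by (simp add: strongly_inductive_def strongly_uniform_def)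
qed

lemma iter_wand_kleene_wand: "kleene_wand C (iter_wand C)"
proof
  show "has_binary_joins C" unfolding has_binary_joins_def by (rule joins_over_any)
qed (fact iter_wand_in_hom iter_wand_unfold iter_wand_comp iter_wand_dinatural iter_wand_diag)+

end

theorem theorem5p16:
  fixes C :: "('o, 'a, 'm) perp_struct_scheme" (structure)
  assumes "disjoint_perp_restriction_category C"
  shows "(\<forall>P A. \<forall>f \<in> hom C P P. \<forall>g \<in> hom C P A. f \<bottom> g \<longrightarrow>
            disj_family C P A (UNIV :: nat set) (\<lambda>n. iter C f n \<Zsemi> g) \<and>
            is_join C P A (UNIV :: nat set) (\<lambda>n. iter C f n \<Zsemi> g) (iter_wand C f g))
       \<and> kleene_wand C (iter_wand C)
       \<and> strongly_inductive C (iter_wand C)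
       \<and> strongly_inductive_perp_itegory C (iter_wand C)"
proof -
  interpret disjoint_perp_restriction_category C by fact
  have "strongly_inductive_perp_itegory C (iter_wand C)"
    unfolding strongly_inductive_perp_itegory_def perp_itegory_def has_binary_joins_def
    using perp_restriction_category_axioms joins_over_any iter_wand_kleene_wand
      iter_wand_strongly_inductive by blast
  then show ?thesis
    using disj_family_iter is_join_iter_wand iter_wand_kleene_wand iter_wand_strongly_inductive
    by blast
qed

end
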